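(* Let $p>1$ and let $(Y_i)_{i\in\mathbb{N}}$ be the stationary Markov chain (with $Y_0$ distributed according to $\pi$) on $\mathbb{N}=\{0,1,2,\dots\}$ which jumps from $0$ to $n>0$ with probability $1/(\zeta(p+1)n^{p+1})$ and from $n>0$ to $n-1$ with probability $1$, where $\pi$ is its invariant probability measure. Let $f:\mathbb{N}\to\mathbb{R}$ be defined by $f(n)=\pi\{0\}-\mathbf{1}_{n=0}$. There exists $\kappa>0$ such that, for any integer $n\ge1$ and any $x\in[\kappa n^{1/p},\kappa^{-1}n]$, $$\mathbb{P}\Big(\sum_{i=0}^{n-1}f(Y_i)\ge x\Big)\ge \kappa^{-1}\frac{n}{x^p}.$$
   Context: The invariant probability measure is given by $\pi\{n\}=\sum_{i\ge n}d/i^{p+1}$ for $n>0$ and $\pi\{0\}=\pi\{1\}$, where $d>0$ is chosen so that $\pi$ has mass $1$. Here $\zeta$ is the Riemann zeta function. The function $f$ has zero average under $\pi$. *)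

theory Defs
  imports "HOL-Probability.Probability"
begin

text \<open>The Riemann zeta function at real arguments \<open>s > 1\<close> (the library does not provide it).\<close>

definition zeta :: "real \<Rightarrow> real" where
  "zeta s = (\<Sum>n. 1 / real (Suc n) powr s)"

text \<open>
  A process \<open>Y\<close> on \<open>M\<close> with countable discrete state space is a time-homogeneous Markov chain with
  initial distribution \<open>\<mu>\<close> and transition kernel \<open>K\<close>: the conditional law of \<open>Y (Suc n)\<close> given a
  history \<open>Y 0 = y 0, \<dots>, Y n = y n\<close> of positive probability is \<open>K (y n)\<close>.
\<close>

definition markov_chain ::
  "'a measure \<Rightarrow> 's::countable pmf \<Rightarrow> ('s \<Rightarrow> 's pmf) \<Rightarrow> (nat \<Rightarrow> 'a \<Rightarrow> 's) \<Rightarrow> bool" where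
  "markov_chain M \<mu> K Y \<longleftrightarrow>
     (\<forall>i. Y i \<in> measurable M (count_space UNIV)) \<and>
     distr M (count_space UNIV) (Y 0) = measure_pmf \<mu> \<and>
     (\<forall>n y z. \<P>(\<omega> in M. \<forall>i\<le>n. Y i \<omega> = y i) > 0 \<longrightarrow>
        \<P>(\<omega> in M. Y (Suc n) \<omega> = z \<bar> \<forall>i\<le>n. Y i \<omega> = y i) = pmf (K (y n)) z)"

definition jump_kernel :: "real \<Rightarrow> nat \<Rightarrow> nat pmf" where
  "jump_kernel p n =
     (if n = 0
      then embed_pmf (\<lambda>k. if k = 0 then 0 else 1 / (zeta (p + 1) * real k powr (p + 1)))
      else return_pmf (n - 1))"

definition centered_indicator :: "nat pmf \<Rightarrow> nat \<Rightarrow> real" where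
  "centered_indicator \<pi> n = pmf \<pi> 0 - indicator {0} n"

lemma summable_powr_Suc:
  assumes "s > 1" shows "summable (\<lambda>n. 1 / real (Suc n) powr s)"
proof -
  have "summable (\<lambda>n. real n powr (- s))"
    using assms by (subst summable_real_powr_iff) auto
  then have "summable (\<lambda>n. real (Suc n) powr (- s))"
    by (subst summable_Suc_iff)
  then show ?thesis by (simp only: powr_minus_divide)
qed

lemma zeta_pos:
  assumes "s > 1" shows "zeta s > 0"
  unfolding zeta_def using summable_powr_Suc[OF assms]
  by (intro suminf_pos) (simp_all del: of_nat_Suc)

lemma pmf_jump_kernel_0:
  assumes "p > 0"
  shows "pmf (jump_kernel p 0) k =
    (if k = 0 then 0 else 1 / (zeta (p + 1) * real k powr (p + 1)))"
proof -
  let ?f = "\<lambda>k::nat. if k = 0 then 0 else 1 / (zeta (p + 1) * real k powr (p + 1))"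
  have z: "zeta (p + 1) > 0" using assms by (simp add: zeta_pos)
  have nn: "?f k \<ge> 0" for k using z by simp
  have "(\<lambda>n. 1 / real (Suc n) powr (p + 1)) sums zeta (p + 1)"
    unfolding zeta_def using assms by (intro summable_sums summable_powr_Suc) simp
  from sums_mult[OF this, of "1 / zeta (p + 1)"]
  have "(\<lambda>n. ?f (Suc n)) sums 1" using z by simp
  from sums_Suc[OF this] have s: "?f sums 1" by simp
  have "(\<integral>\<^sup>+x. ennreal (?f x) \<partial>count_space UNIV) = 1"
    by (subst nn_integral_count_space_nat, subst suminf_ennreal2)
       (use s nn in \<open>auto simp: sums_iff simp del: if_split\<close>)
  then have "pmf (embed_pmf ?f) k = ?f k"
    by (intro pmf_embed_pmf) (use nn in auto)
  then show ?thesis by (simp add: jump_kernel_def)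
qed

lemma pmf_jump_kernel:
  assumes "p > 0"
  shows "pmf (jump_kernel p n) k =
    (if n = 0 then (if k = 0 then 0 else 1 / (zeta (p + 1) * real k powr (p + 1)))
     else indicator {n - 1} k)"
proof (cases "n = 0")
  case True then show ?thesis using pmf_jump_kernel_0[OF assms] by simp
next
  case False then show ?thesis
    by (auto simp: jump_kernel_def pmf_return indicator_def)
qed

lemma sums_pmf_nat: "pmf (\<pi>::nat pmf) sums 1"
proof -
  have "(\<integral>\<^sup>+x. ennreal (pmf \<pi> x) \<partial>count_space UNIV) = 1"
    using measure_pmf.emeasure_space_1[of \<pi>] by (subst nn_integral_pmf) simp
  then have "(\<Sum>n. ennreal (pmf \<pi> n)) = ennreal 1"
    by (simp only: nn_integral_count_space_nat ennreal_1)
  then have "(\<lambda>n. ennreal (pmf \<pi> n)) sums ennreal 1"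
    using summable_sums[OF summableI, of "\<lambda>n. ennreal (pmf \<pi> n)"] by (simp only:)
  then show ?thesis by (subst (asm) sums_ennreal) simp_all
qed

lemma integrable_pmf_indicator: "integrable (measure_pmf \<pi>) (indicator A :: _ \<Rightarrow> real)"
  by (intro measure_pmf.integrable_const_bound[where B = 1]) (auto simp: indicator_def)

lemma centered_indicator_zero_average:
  "measure_pmf.expectation \<pi> (centered_indicator \<pi>) = 0"
proof -
  have "measure_pmf.expectation \<pi> (indicator {0::nat} :: nat \<Rightarrow> real) = pmf \<pi> 0"
    by (simp add: pmf.rep_eq)
  then show ?thesis
    unfolding centered_indicator_def
    by (subst Bochner_Integration.integral_diff) (auto simp: integrable_pmf_indicator)
qed

lemma pmf_bind_jump_kernel:
  assumes "p > 0"
  shows "pmf (bind_pmf \<pi> (jump_kernel p)) k =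
    pmf \<pi> 0 * pmf (jump_kernel p 0) k + pmf \<pi> (Suc k)"
proof -
  have split: "pmf (jump_kernel p n) k =
     indicator {0} n * pmf (jump_kernel p 0) k + indicator {Suc k} n" for n
    by (auto simp: pmf_jump_kernel[OF assms] indicator_def)
  have "pmf (bind_pmf \<pi> (jump_kernel p)) k =
     measure_pmf.expectation \<pi> (\<lambda>n. indicator {0} n * pmf (jump_kernel p 0) k + indicator {Suc k} n)"
    unfolding pmf_bind by (intro Bochner_Integration.integral_cong refl split)
  also have "\<dots> = pmf \<pi> 0 * pmf (jump_kernel p 0) k + pmf \<pi> (Suc k)"
    by (subst Bochner_Integration.integral_add)
       (auto simp: pmf.rep_eq integrable_pmf_indicator)
  finally show ?thesis .
qed

lemma summable_powr_shift:
  assumes "s > 1" shows "summable (\<lambda>i. d / real (n + i) powr s)"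
proof -
  have "summable (\<lambda>n. real n powr (- s))"
    using assms by (subst summable_real_powr_iff) auto
  then have "summable (\<lambda>i. real (i + n) powr (- s))"
    by (subst summable_iff_shift)
  then have "summable (\<lambda>i. d * real (i + n) powr (- s))"
    by (rule summable_mult)
  then show ?thesis by (simp add: powr_minus_divide add.commute)
qed

text \<open>
  The invariant probability measure exists, is unique, and is given by the explicit formula
  \<open>\<pi>{n} = (\<Sum>i\<ge>n. d / i\<^sup>p\<^sup>+\<^sup>1)\<close> for \<open>n > 0\<close> and \<open>\<pi>{0} = \<pi>{1}\<close>; as \<open>\<pi>\<close> is a \<open>pmf\<close>, the condition that
  \<open>d\<close> normalises the mass to 1 is implicit.
\<close>

lemma jump_kernel_invariant_iff:
  fixes \<pi> :: "nat pmf"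
  assumes "p > 1"
  shows "bind_pmf \<pi> (jump_kernel p) = \<pi> \<longleftrightarrow>
    (\<exists>d>0. (\<forall>n>0. pmf \<pi> n = (\<Sum>i. d / real (n + i) powr (p + 1))) \<and> pmf \<pi> 0 = pmf \<pi> 1)"
proof
  have p0: "p > 0" using assms by simp
  have z: "zeta (p + 1) > 0" using assms by (simp add: zeta_pos)
  {
    assume inv: "bind_pmf \<pi> (jump_kernel p) = \<pi>"
    define d where "d = pmf \<pi> 0 / zeta (p + 1)"
    have rec: "pmf \<pi> k = pmf \<pi> 0 * pmf (jump_kernel p 0) k + pmf \<pi> (Suc k)" for k
      using pmf_bind_jump_kernel[OF p0, of \<pi> k] inv by simp
    have formula: "pmf \<pi> n = (\<Sum>i. d / real (n + i) powr (p + 1))" if "n > 0" for n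
    proof -
      have "(\<lambda>i. pmf \<pi> i) \<longlonglongrightarrow> 0"
        using sums_pmf_nat[of \<pi>] by (intro summable_LIMSEQ_zero) (auto simp: sums_iff)
      then have "(\<lambda>i. pmf \<pi> (n + i)) \<longlonglongrightarrow> 0"
        by (subst add.commute, rule LIMSEQ_ignore_initial_segment)
      from telescope_sums'[OF this]
      have "(\<lambda>i. pmf \<pi> (n + i) - pmf \<pi> (n + Suc i)) sums pmf \<pi> n" by simp
      moreover have "pmf \<pi> (n + i) - pmf \<pi> (n + Suc i) = d / real (n + i) powr (p + 1)" for i
        using rec[of "n + i"] that by (simp add: pmf_jump_kernel_0[OF p0] d_def)
      ultimately show ?thesis by (simp add: sums_iff)
    qed
    have "pmf \<pi> 0 \<noteq> 0"
    proof
      assume "pmf \<pi> 0 = 0"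
      then have "pmf \<pi> n = 0" for n
        using formula[of n] by (cases "n = 0") (auto simp: d_def)
      then have "pmf \<pi> = (\<lambda>_. 0)" by (intro ext)
      then show False using sums_pmf_nat[of \<pi>] by (simp add: sums_iff)
    qed
    then have "d > 0" using z by (simp add: d_def pmf_pos)
    moreover have "pmf \<pi> 0 = pmf \<pi> 1"
      using rec[of 0] by (simp add: pmf_jump_kernel_0[OF p0])
    ultimately show "\<exists>d>0. (\<forall>n>0. pmf \<pi> n = (\<Sum>i. d / real (n + i) powr (p + 1)))
        \<and> pmf \<pi> 0 = pmf \<pi> 1"
      using formula by blast
  }
  {
    assume "\<exists>d>0. (\<forall>n>0. pmf \<pi> n = (\<Sum>i. d / real (n + i) powr (p + 1))) \<and> pmf \<pi> 0 = pmf \<pi> 1"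
    then obtain d where d: "d > 0" "pmf \<pi> 0 = pmf \<pi> 1"
      and f: "\<And>n. n > 0 \<Longrightarrow> pmf \<pi> n = (\<Sum>i. d / real (n + i) powr (p + 1))" by blast
    have "pmf \<pi> 0 = (\<Sum>i. d * (1 / real (Suc i) powr (p + 1)))"
      using d(2) f[of 1] by simp
    also have "\<dots> = d * zeta (p + 1)"
      unfolding zeta_def using assms by (intro suminf_mult summable_powr_Suc) simp
    finally have 0: "pmf \<pi> 0 = d * zeta (p + 1)" .
    have "pmf (bind_pmf \<pi> (jump_kernel p)) k = pmf \<pi> k" for k
    proof (cases "k = 0")
      case True
      then show ?thesis
        using d by (simp add: pmf_bind_jump_kernel[OF p0] pmf_jump_kernel_0[OF p0])
    next
      case False
      have "summable (\<lambda>i. d / real (k + i) powr (p + 1))"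
        using assms by (intro summable_powr_shift) simp
      from suminf_split_head[OF this]
      have "pmf \<pi> k = d / real k powr (p + 1) + pmf \<pi> (Suc k)"
        using False f[of k] f[of "Suc k"] by simp
      then show ?thesis
        using False 0 z by (simp add: pmf_bind_jump_kernel[OF p0] pmf_jump_kernel_0[OF p0])
    qed
    then show "bind_pmf \<pi> (jump_kernel p) = \<pi>" by (intro pmf_eqI) simp
  }
qed

lemma suminf_swap_ennreal:
  fixes F :: "nat \<Rightarrow> nat \<Rightarrow> ennreal"
  shows "(\<Sum>n. \<Sum>k. F n k) = (\<Sum>k. \<Sum>n. F n k)"
proof -
  have "(\<Sum>n. \<Sum>k. F n k) = (\<integral>\<^sup>+n. (\<Sum>k. F n k) \<partial>count_space UNIV)"
    by (simp only: nn_integral_count_space_nat)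
  also have "\<dots> = (\<Sum>k. \<integral>\<^sup>+n. F n k \<partial>count_space UNIV)"
    by (rule nn_integral_suminf) simp
  also have "\<dots> = (\<Sum>k. \<Sum>n. F n k)"
    by (simp only: nn_integral_count_space_nat)
  finally show ?thesis .
qed

lemma ex1_jump_kernel_invariant:
  assumes "p > 1"
  shows "\<exists>!\<pi>. bind_pmf \<pi> (jump_kernel p) = \<pi>"
proof (rule ex_ex1I)
  define S where "S n = (\<Sum>i. 1 / real (n + i) powr (p + 1))" for n :: nat
  have dS: "(\<Sum>i. d / real (n + i) powr (p + 1)) = d * S n" for d n
    unfolding S_def using suminf_mult[OF summable_powr_shift[of "p + 1" 1 n], of d] assms by simp
  {
    define g where "g n = (if n = 0 then S 1 else S n)" for n
    have sumS: "summable (\<lambda>i. 1 / real (n + i) powr (p + 1))" for n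
      using assms by (intro summable_powr_shift) simp
    have Snn: "S n \<ge> 0" for n unfolding S_def by (intro suminf_nonneg sumS) simp
    then have gnn: "g n \<ge> 0" for n by (simp add: g_def)
    have S1: "S 1 > 0" unfolding S_def by (intro suminf_pos sumS) simp
    have "(\<Sum>n. ennreal (S (Suc n))) =
        (\<Sum>n. \<Sum>k. ennreal (if n \<le> k then 1 / real (Suc k) powr (p + 1) else 0))"
    proof (rule suminf_cong)
      fix n
      let ?h = "\<lambda>k. if n \<le> k then 1 / real (Suc k) powr (p + 1) else 0"
      have "(\<lambda>i. 1 / real (Suc n + i) powr (p + 1)) sums S (Suc n)"
        unfolding S_def by (intro summable_sums sumS)
      then have "(\<lambda>i. ?h (i + n)) sums S (Suc n)" by (simp add: add_ac)
      then have "?h sums S (Suc n)" by (subst (asm) sums_iff_shift) simp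
      then show "ennreal (S (Suc n)) = (\<Sum>k. ennreal (?h k))"
        by (subst suminf_ennreal2) (auto simp: sums_iff)
    qed
    also have "\<dots> = (\<Sum>k. \<Sum>n. ennreal (if n \<le> k then 1 / real (Suc k) powr (p + 1) else 0))"
      by (rule suminf_swap_ennreal)
    also have "\<dots> = (\<Sum>k. ennreal (1 / real (Suc k) powr p))"
    proof (rule suminf_cong)
      fix k
      have "(\<Sum>n. ennreal (if n \<le> k then 1 / real (Suc k) powr (p + 1) else 0))
          = (\<Sum>n\<le>k. ennreal (1 / real (Suc k) powr (p + 1)))"
        by (subst suminf_finite[of "{..k}"]) auto
      also have "\<dots> = ennreal (real (Suc k) * (1 / real (Suc k) powr (p + 1)))"
        by (subst sum_ennreal) auto
      also have "real (Suc k) * (1 / real (Suc k) powr (p + 1)) = 1 / real (Suc k) powr p"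
        by (simp add: powr_add del: of_nat_Suc)
      finally show "(\<Sum>n. ennreal (if n \<le> k then 1 / real (Suc k) powr (p + 1) else 0))
          = ennreal (1 / real (Suc k) powr p)" .
    qed
    also have "\<dots> = ennreal (zeta p)"
      unfolding zeta_def using assms by (intro suminf_ennreal2 summable_powr_Suc) auto
    finally have fin: "(\<Sum>n. ennreal (S (Suc n))) = ennreal (zeta p)" .
    then have "(\<lambda>n. ennreal (S (Suc n))) sums ennreal (zeta p)"
      using summable_sums[OF summableI, of "\<lambda>n. ennreal (S (Suc n))"] by (simp only:)
    then have "(\<lambda>n. S (Suc n)) sums zeta p"
      using zeta_pos[OF assms] by (subst (asm) sums_ennreal) (auto simp: Snn)
    then have g_sums: "(\<lambda>n. g (Suc n)) sums zeta p" by (simp add: g_def)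
    have "g 0 = S 1" by (simp add: g_def)
    with sums_Suc[OF g_sums] have gs: "g sums (zeta p + S 1)" by metis
    define T where "T = zeta p + S 1"
    have T: "T > 0" using zeta_pos[OF assms] S1 by (simp add: T_def)
    have gT: "(\<lambda>n. g n / T) sums 1" using sums_divide[OF gs, of T] T by (simp add: T_def)
    have "(\<integral>\<^sup>+x. ennreal (g x / T) \<partial>count_space UNIV) = 1"
      using gT gnn T by (subst nn_integral_count_space_nat, subst suminf_ennreal2) (auto simp: sums_iff)
    then have pm: "pmf (embed_pmf (\<lambda>n. g n / T)) n = g n / T" for n
      using gnn T by (intro pmf_embed_pmf) auto
    define \<pi> where "\<pi> = embed_pmf (\<lambda>n. g n / T)"
    have "pmf \<pi> n = (\<Sum>i. (1 / T) / real (n + i) powr (p + 1))" if "n > 0" for n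
      unfolding dS using that by (simp add: \<pi>_def pm g_def[of n])
    moreover have "pmf \<pi> 0 = pmf \<pi> 1"
      by (simp add: \<pi>_def pm g_def[of 0] g_def[of 1] del: One_nat_def)
    ultimately have "bind_pmf \<pi> (jump_kernel p) = \<pi>"
      unfolding jump_kernel_invariant_iff[OF assms]
      using T by (intro exI[of _ "1 / T"]) simp
    then show "\<exists>\<pi>. bind_pmf \<pi> (jump_kernel p) = \<pi>" by blast
  }
  {
    fix \<pi> \<rho> :: "nat pmf"
    assume "bind_pmf \<pi> (jump_kernel p) = \<pi>" "bind_pmf \<rho> (jump_kernel p) = \<rho>"
    then obtain c d where c: "c > 0" "\<And>n. n > 0 \<Longrightarrow> pmf \<pi> n = c * S n" "pmf \<pi> 0 = pmf \<pi> 1"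
      and d: "d > 0" "\<And>n. n > 0 \<Longrightarrow> pmf \<rho> n = d * S n" "pmf \<rho> 0 = pmf \<rho> 1"
      unfolding jump_kernel_invariant_iff[OF assms] dS by blast
    have eq: "pmf \<pi> n = (c / d) * pmf \<rho> n" for n
      using c d by (cases "n = 0") auto
    have "pmf \<pi> sums (c / d * 1)"
      unfolding eq by (intro sums_mult sums_pmf_nat)
    then have "c / d = 1" using sums_pmf_nat[of \<pi>] sums_unique2 by fastforce
    then show "\<pi> = \<rho>" using eq by (intro pmf_eqI) simp
  }
qed

end

theory Submission
  imports Defs "HOL-Real_Asymp.Real_Asymp"
begin

text \<open>
  Write \<open>q = \<pi>{0}\<close> and let \<open>J\<close> be the law of a jump from \<open>0\<close>. After a jump of size \<open>j\<close> the chain walks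
  straight back, so successive visits to \<open>0\<close> are separated by independent times \<open>T\<close> distributed as \<open>J + 1\<close>.
  The Birkhoff sum of \<open>f\<close> up to time \<open>n\<close> equals \<open>n q\<close> minus the number of visits to \<open>0\<close> before \<open>n\<close>; it is
  at least \<open>x\<close> as soon as there are at most \<open>n q - x\<close> visits, hence as soon as the sum of
  \<open>k = \<lfloor>n q - x\<rfloor>\<close> return times reaches \<open>n\<close> (\<open>prob_centered_sum_ge\<close>). As \<open>T\<close> has mean \<open>1 / q\<close>, the sum
  of \<open>k\<close> return times must exceed its mean by about \<open>x / q\<close>.

  Since \<open>T\<close> has a tail of order \<open>t\<close> to the power \<open>-p\<close>, one of the \<open>k\<close> return times exceeds
  \<open>L \<approx> 4 x / q\<close> with probability of order \<open>n / x\<^sup>p\<close>, which is the claimed bound. What remains is that the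
  other return times do not destroy the gain with a probability bounded away from \<open>0\<close>
  (\<open>one_big_jump\<close> combines the two events). This has to hold even when \<open>x\<close> is much smaller than the
  typical fluctuations of the sum, which happens for \<open>p > 2\<close>, so Chebyshev's inequality alone is not
  enough. Truncate the return times at \<open>L\<close>. The truncation shifts the mean of the sum by at most
  a constant times \<open>n\<close> times \<open>L\<close> to the power \<open>1 - p\<close>, which is small compared with \<open>L\<close> because
  \<open>n\<close> is small compared with \<open>x\<^sup>p\<close>. Let \<open>V\<close> be the variance of the truncated sum. If \<open>V\<close> is small compared
  with \<open>L\<^sup>2\<close>, Chebyshev's inequality applies. Otherwise the summands are bounded by a multiple of the
  standard deviation of the sum, so the fourth moment of the centred sum is at most a constant times \<open>V\<^sup>2\<close>,
  and a centred variable with this property is nonnegative with a probability bounded below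
  (\<open>bounded_iid_sum_not_far_below_mean\<close>). This dichotomy treats all \<open>p > 1\<close> at once.
\<close>

section \<open>Sums of independent copies\<close>

primrec iid_sum :: "nat pmf \<Rightarrow> nat \<Rightarrow> nat pmf" where
  "iid_sum T 0 = return_pmf 0"
| "iid_sum T (Suc k) = bind_pmf T (\<lambda>t. map_pmf ((+) t) (iid_sum T k))"

lemma measure_bind_pmf_eq_expectation:
  "measure (measure_pmf (bind_pmf P N)) X = (\<integral>x. measure (measure_pmf (N x)) X \<partial>measure_pmf P)"
proof -
  have "ennreal (measure (measure_pmf (bind_pmf P N)) X) = (\<integral>\<^sup>+x. ennreal (measure (measure_pmf (N x)) X) \<partial>measure_pmf P)"
    by (simp flip: measure_pmf.emeasure_eq_measure)
  also have "\<dots> = ennreal (\<integral>x. measure (measure_pmf (N x)) X \<partial>measure_pmf P)"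
    by (intro nn_integral_eq_integral measure_pmf.integrable_const_bound[where B = 1]) auto
  finally show ?thesis by simp
qed

lemma integrable_pmf_bounded:
  fixes f :: "'b \<Rightarrow> real"
  assumes "\<And>x. \<bar>f x\<bar> \<le> B"
  shows "integrable (measure_pmf P) f"
  by (intro measure_pmf.integrable_const_bound[where B = B]) (use assms in auto)

text \<open>
  The events are written with an offset \<open>c\<close> inside the inequality because the recursion then only moves
  the first summand into the offset, without subtraction on the natural numbers.
\<close>
lemma measure_iid_sum_Suc:
  "measure (iid_sum T (Suc k)) {r. n \<le> c + r} =
     (\<integral>t. measure (iid_sum T k) {r. n \<le> c + t + r} \<partial>measure_pmf T)"
  by (simp add: measure_bind_pmf_eq_expectation vimage_def add.assoc)

lemma emeasure_iid_sum_Suc: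
  "emeasure (iid_sum T (Suc k)) {r. n \<le> c + r} =
     (\<integral>\<^sup>+t. emeasure (iid_sum T k) {r. n \<le> c + t + r} \<partial>measure_pmf T)"
  by (simp add: vimage_def add.assoc)

section \<open>Visits to zero as a renewal process\<close>

context
  fixes M :: "'a measure" and \<mu> :: "nat pmf" and K :: "nat \<Rightarrow> nat pmf" and Y :: "nat \<Rightarrow> 'a \<Rightarrow> nat"
  assumes M: "prob_space M" and chain: "markov_chain M \<mu> K Y"
begin

interpretation prob_space M by (rule M)

lemma measurable_chain [measurable]: "Y i \<in> measurable M (count_space UNIV)"
  using chain by (simp add: markov_chain_def)

lemma emeasure_partition_by_state:
  assumes [measurable]: "Measurable.pred M Q"
  shows "emeasure M {\<omega>\<in>space M. Q \<omega>} =
    (\<integral>\<^sup>+z. emeasure M {\<omega>\<in>space M. Y j \<omega> = z \<and> Q \<omega>} \<partial>count_space UNIV)"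
proof -
  have "{\<omega>\<in>space M. Q \<omega>} = (\<Union>z. {\<omega>\<in>space M. Y j \<omega> = z \<and> Q \<omega>})" by auto
  then show ?thesis
    by (simp only:) (intro emeasure_UN_countable, auto simp: disjoint_family_on_def)
qed

lemma emeasure_history_Suc:
  "emeasure M {\<omega>\<in>space M. \<forall>i\<le>Suc m. Y i \<omega> = (h(Suc m := z)) i} =
     emeasure M {\<omega>\<in>space M. \<forall>i\<le>m. Y i \<omega> = h i} * pmf (K (h m)) z"
proof -
  let ?H = "{\<omega>\<in>space M. \<forall>i\<le>m. Y i \<omega> = h i}"
  let ?H' = "{\<omega>\<in>space M. Y (Suc m) \<omega> = z \<and> (\<forall>i\<le>m. Y i \<omega> = h i)}"
  have eq: "{\<omega>\<in>space M. \<forall>i\<le>Suc m. Y i \<omega> = (h(Suc m := z)) i} = ?H'"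
    by (auto simp: le_Suc_eq)
  have "prob ?H' = prob ?H * pmf (K (h m)) z"
  proof (cases "prob ?H > 0")
    case True
    then have "\<P>(\<omega> in M. Y (Suc m) \<omega> = z \<bar> \<forall>i\<le>m. Y i \<omega> = h i) = pmf (K (h m)) z"
      using chain unfolding markov_chain_def by blast
    then show ?thesis using True by (auto simp: cond_prob_def field_simps)
  next
    case False
    then have "prob ?H = 0" using measure_nonneg[of M ?H] by linarith
    moreover have "prob ?H' \<le> prob ?H" by (intro finite_measure_mono) auto
    ultimately show ?thesis using measure_nonneg[of M ?H'] by auto
  qed
  then show ?thesis by (simp only: eq emeasure_eq_measure ennreal_mult' measure_nonneg pmf_nonneg)
qed

lemma emeasure_initial:
  "emeasure M {\<omega>\<in>space M. Y 0 \<omega> = y} = pmf \<mu> y"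
proof -
  have "emeasure (distr M (count_space UNIV) (Y 0)) {y} = emeasure (measure_pmf \<mu>) {y}"
    using chain by (simp add: markov_chain_def)
  then show ?thesis
    by (subst (asm) emeasure_distr)
       (auto simp: emeasure_pmf_single vimage_def Int_def conj_commute)
qed

lemma pred_count_zeros [measurable]:
  "Measurable.pred M (\<lambda>\<omega>. (\<Sum>i=m..<l. of_bool (Y i \<omega> = 0)) \<le> (k::nat))"
  by measurable

end

text \<open>
  Given the past up to time \<open>m\<close>, there are at most \<open>k\<close> visits to \<open>0\<close> in the next \<open>n\<close> time steps iff the walk
  down from the current state followed by \<open>k\<close> complete returns lasts at least \<open>n\<close> steps: the visit number
  \<open>k + 1\<close> then falls outside of the time window. Conditioning on a whole history makes the Markov property
  directly applicable, and both sides satisfy the same recursion in \<open>n\<close>.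
\<close>
lemma emeasure_visits_given_history:
  assumes M: "prob_space M" and chain: "markov_chain M \<pi> (jump_kernel p) Y"
  shows "emeasure M {\<omega>\<in>space M. (\<forall>i\<le>m. Y i \<omega> = h i) \<and> (\<Sum>i=m..<m+n. of_bool (Y i \<omega> = 0)) \<le> k} =
    emeasure M {\<omega>\<in>space M. \<forall>i\<le>m. Y i \<omega> = h i} *
    emeasure (iid_sum (map_pmf Suc (jump_kernel p 0)) k) {r. n \<le> h m + r}"
proof (induction n arbitrary: m h k)
  case 0
  then show ?case by simp
next
  case (Suc n)
  note [measurable] = measurable_chain[OF M chain]
  let ?T = "map_pmf Suc (jump_kernel p 0)"
  let ?H = "{\<omega>\<in>space M. \<forall>i\<le>m. Y i \<omega> = h i}"
  have step: "emeasure M {\<omega>\<in>space M. (\<forall>i\<le>m. Y i \<omega> = h i) \<and> (\<Sum>i=Suc m..<Suc m+n. of_bool (Y i \<omega> = 0)) \<le> k} =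
    emeasure M ?H * (\<integral>\<^sup>+z. emeasure (iid_sum ?T k) {r. n \<le> z + r} \<partial>jump_kernel p (h m))" for k :: nat
  proof -
    have "emeasure M {\<omega>\<in>space M. (\<forall>i\<le>m. Y i \<omega> = h i) \<and> (\<Sum>i=Suc m..<Suc m+n. of_bool (Y i \<omega> = 0)) \<le> k}
       = (\<integral>\<^sup>+z. emeasure M {\<omega>\<in>space M. Y (Suc m) \<omega> = z \<and> (\<forall>i\<le>m. Y i \<omega> = h i) \<and>
            (\<Sum>i=Suc m..<Suc m+n. of_bool (Y i \<omega> = 0)) \<le> k} \<partial>count_space UNIV)"
      by (rule emeasure_partition_by_state[OF M chain]) measurable
    also have "\<dots> = (\<integral>\<^sup>+z. emeasure M ?H * (ennreal (pmf (jump_kernel p (h m)) z) * emeasure (iid_sum ?T k) {r. n \<le> z + r}) \<partial>count_space UNIV)"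
    proof (rule nn_integral_cong)
      fix z
      have "{\<omega>\<in>space M. Y (Suc m) \<omega> = z \<and> (\<forall>i\<le>m. Y i \<omega> = h i) \<and> (\<Sum>i=Suc m..<Suc m+n. of_bool (Y i \<omega> = 0)) \<le> k}
        = {\<omega>\<in>space M. (\<forall>i\<le>Suc m. Y i \<omega> = (h(Suc m := z)) i) \<and> (\<Sum>i=Suc m..<Suc m+n. of_bool (Y i \<omega> = 0)) \<le> k}"
        by (auto simp: le_Suc_eq)
      then show "emeasure M {\<omega>\<in>space M. Y (Suc m) \<omega> = z \<and> (\<forall>i\<le>m. Y i \<omega> = h i) \<and> (\<Sum>i=Suc m..<Suc m+n. of_bool (Y i \<omega> = 0)) \<le> k}
         = emeasure M ?H * (ennreal (pmf (jump_kernel p (h m)) z) * emeasure (iid_sum ?T k) {r. n \<le> z + r})"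
        using Suc.IH[of "Suc m" "h(Suc m := z)" k] emeasure_history_Suc[OF M chain, of m h z]
        by (simp add: mult.assoc)
    qed
    also have "\<dots> = emeasure M ?H * (\<integral>\<^sup>+z. emeasure (iid_sum ?T k) {r. n \<le> z + r} \<partial>jump_kernel p (h m))"
      by (subst nn_integral_cmult) (simp_all add: nn_integral_measure_pmf)
    finally show ?thesis .
  qed
  let ?N = "\<lambda>m n \<omega>. \<Sum>i=m..<m+n. of_bool (Y i \<omega> = 0) :: nat"
  \<comment> \<open>The visit at time \<open>m\<close> itself is decided by the history.\<close>
  have split: "?N m (Suc n) \<omega> = of_bool (h m = 0) + ?N (Suc m) n \<omega>"
    if "\<forall>i\<le>m. Y i \<omega> = h i" for \<omega>
    using that by (subst sum.atLeast_Suc_lessThan) auto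
  show ?case
  proof (cases "h m")
    case 0
    show ?thesis
    proof (cases k)
      case k0: 0
      have "{\<omega>\<in>space M. (\<forall>i\<le>m. Y i \<omega> = h i) \<and> ?N m (Suc n) \<omega> \<le> k} = {}"
        using split 0 k0 by fastforce
      then show ?thesis using 0 k0 by (simp only: emeasure_empty) simp
    next
      case (Suc k')
      have "((\<forall>i\<le>m. Y i \<omega> = h i) \<and> ?N m (Suc n) \<omega> \<le> k)
         = ((\<forall>i\<le>m. Y i \<omega> = h i) \<and> ?N (Suc m) n \<omega> \<le> k')" for \<omega>
        using split[of \<omega>] unfolding 0 Suc by (intro conj_cong refl) simp
      moreover have "(\<integral>\<^sup>+z. emeasure (iid_sum ?T k') {r. n \<le> z + r} \<partial>jump_kernel p (h m))
         = emeasure (iid_sum ?T k) {r. Suc n \<le> h m + r}"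
        unfolding Suc emeasure_iid_sum_Suc using 0 by simp
      ultimately show ?thesis by (simp only: step)
    qed
  next
    case (Suc y)
    have "((\<forall>i\<le>m. Y i \<omega> = h i) \<and> ?N m (Suc n) \<omega> \<le> k)
       = ((\<forall>i\<le>m. Y i \<omega> = h i) \<and> ?N (Suc m) n \<omega> \<le> k)" for \<omega>
      using split[of \<omega>] unfolding Suc by (intro conj_cong refl) simp
    moreover have "(\<integral>\<^sup>+z. emeasure (iid_sum ?T k) {r. n \<le> z + r} \<partial>jump_kernel p (h m))
       = emeasure (iid_sum ?T k) {r. Suc n \<le> h m + r}"
      using Suc by (simp add: jump_kernel_def)
    ultimately show ?thesis by (simp only: step)
  qed
qed

text \<open>
  The walk from the initial state to \<open>0\<close> only delays the visits, so it may be dropped in a lower bound.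
\<close>
lemma prob_few_visits_ge:
  assumes M: "prob_space M" and chain: "markov_chain M \<pi> (jump_kernel p) Y"
  shows "measure (iid_sum (map_pmf Suc (jump_kernel p 0)) k) {r. n \<le> r} \<le>
    \<P>(\<omega> in M. (\<Sum>i<n. of_bool (Y i \<omega> = 0)) \<le> k)"
proof -
  interpret prob_space M by (rule M)
  note [measurable] = measurable_chain[OF M chain]
  let ?R = "iid_sum (map_pmf Suc (jump_kernel p 0)) k"
  let ?Q = "\<lambda>\<omega>. (\<Sum>i=0..<0+n. of_bool (Y i \<omega> = 0)) \<le> k"
  have "emeasure ?R {r. n \<le> r} = (\<integral>\<^sup>+y. ennreal (pmf \<pi> y) * emeasure ?R {r. n \<le> r} \<partial>count_space UNIV)"
    by (simp only: nn_integral_measure_pmf[symmetric] nn_integral_const measure_pmf.emeasure_space_1 mult_1_right)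
  also have "\<dots> \<le> (\<integral>\<^sup>+y. ennreal (pmf \<pi> y) * emeasure ?R {r. n \<le> y + r} \<partial>count_space UNIV)"
    by (intro nn_integral_mono mult_left_mono emeasure_mono) auto
  also have "\<dots> = (\<integral>\<^sup>+y. emeasure M {\<omega>\<in>space M. Y 0 \<omega> = y \<and> ?Q \<omega>} \<partial>count_space UNIV)"
  proof (rule nn_integral_cong)
    fix y
    have "{\<omega>\<in>space M. \<forall>i\<le>0. Y i \<omega> = y} = {\<omega>\<in>space M. Y 0 \<omega> = y}"
      "{\<omega>\<in>space M. (\<forall>i\<le>0. Y i \<omega> = y) \<and> ?Q \<omega>} = {\<omega>\<in>space M. Y 0 \<omega> = y \<and> ?Q \<omega>}"
      by auto
    with emeasure_visits_given_history[OF M chain, of 0 "\<lambda>_. y" n k] emeasure_initial[OF M chain, of y]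
    show "ennreal (pmf \<pi> y) * emeasure ?R {r. n \<le> y + r} = emeasure M {\<omega>\<in>space M. Y 0 \<omega> = y \<and> ?Q \<omega>}"
      by (simp only:)
  qed
  also have "\<dots> = emeasure M {\<omega>\<in>space M. ?Q \<omega>}"
    by (rule emeasure_partition_by_state[OF M chain, symmetric]) measurable
  finally have "ennreal (measure ?R {r. n \<le> r}) \<le> ennreal (\<P>(\<omega> in M. ?Q \<omega>))"
    by (simp only: measure_pmf.emeasure_eq_measure emeasure_eq_measure)
  then show ?thesis
    by (simp only: ennreal_le_iff measure_nonneg add_0 atLeast0LessThan)
qed

lemma set_pmf_iid_sum_finite:
  "finite (set_pmf T) \<Longrightarrow> finite (set_pmf (iid_sum T k))"
  by (induction k) auto

section \<open>One large summand\<close>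

lemma measure_iid_sum_truncate_le:
  "measure (iid_sum (map_pmf (min L) T) k) {r. n \<le> c + r} \<le> measure (iid_sum T k) {r. n \<le> c + r}"
proof (induction k arbitrary: c)
  case (Suc k)
  let ?F = "\<lambda>c. measure (iid_sum (map_pmf (min L) T) k) {r. n \<le> c + r}"
  let ?G = "\<lambda>c. measure (iid_sum T k) {r. n \<le> c + r}"
  have "?F (c + min L t) \<le> ?G (c + t)" for t
  proof -
    have "?F (c + min L t) \<le> ?F (c + t)"
      by (intro measure_pmf.finite_measure_mono) auto
    then show ?thesis using Suc[of "c + t"] by linarith
  qed
  then show ?case
    unfolding measure_iid_sum_Suc integral_map_pmf
    by (intro integral_mono integrable_pmf_bounded[where B = 1]) auto
qed simp

text \<open>
  A Bonferroni bound: summing over which of the \<open>k + 1\<close> summands is at least \<open>L\<close>, while the other \<open>k\<close>,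
  truncated at \<open>L\<close>, push the sum to the target. The correction \<open>k a\<close> pays for counting configurations with
  several large summands more than once. Conditioning on the first summand turns this into
  an induction: it is either the large one, or it is small and unchanged by the truncation.
\<close>
lemma one_big_jump:
  fixes T :: "nat pmf" and L k n c :: nat
  defines "a \<equiv> measure T {L..}"
  shows "real (Suc k) * a * (measure (iid_sum (map_pmf (min L) T) k) {r. n \<le> c + L + r} - real k * a)
    \<le> measure (iid_sum T (Suc k)) {r. n \<le> c + r}"
proof (induction k arbitrary: c)
  case 0
  have "a * indicator {r. n \<le> c + L + r} 0 \<le> (\<integral>t. indicator {L..} t * indicator {r. n \<le> c + L + r} (0::nat) \<partial>measure_pmf T)"
    by (simp add: a_def)
  also have "\<dots> \<le> (\<integral>t. indicator {r. n \<le> c + t + r} 0 \<partial>measure_pmf T)"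
    by (intro integral_mono integrable_pmf_bounded[where B = 1]) (auto simp: indicator_def)
  also have "\<dots> = measure (iid_sum T (Suc 0)) {r. n \<le> c + r}"
    unfolding measure_iid_sum_Suc by simp
  finally show ?case by simp
next
  case (Suc k)
  let ?T' = "map_pmf (min L) T"
  let ?R = "\<lambda>j c. measure (iid_sum T j) {r. n \<le> c + r}"
  let ?R' = "\<lambda>j c. measure (iid_sum ?T' j) {r. n \<le> c + r}"
  let ?b = "real (Suc k) * a"
  have a: "0 \<le> a" "a \<le> 1" by (auto simp: a_def)
  have pt: "indicator {L..} t * ?R' (Suc k) (c + L) + ?b * (?R' k (c + L + min L t) - indicator {L..} t - real k * a)
     \<le> ?R (Suc k) (c + t)" for t
  proof (cases "L \<le> t")
    case True
    have "?R' (Suc k) (c + L) \<le> ?R' (Suc k) (c + t)"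
      using True by (intro measure_pmf.finite_measure_mono) auto
    also have "\<dots> \<le> ?R (Suc k) (c + t)" by (rule measure_iid_sum_truncate_le)
    finally have "?R' (Suc k) (c + L) \<le> ?R (Suc k) (c + t)" .
    \<comment> \<open>On a large first summand the second part of the lower bound is nonpositive.\<close>
    moreover have "?b * (?R' k (c + L + min L t) - 1 - real k * a) \<le> 0"
    proof (intro mult_nonneg_nonpos)
      have "?R' k (c + L + min L t) \<le> 1" by simp
      moreover have "0 \<le> real k * a" using a by simp
      ultimately show "?R' k (c + L + min L t) - 1 - real k * a \<le> 0" by linarith
    qed (use a in simp)
    ultimately show ?thesis using True by simp
  next
    case False
    then have "min L t = t" by simp
    then show ?thesis using False Suc[of "c + t"] by (simp add: add_ac del: iid_sum.simps)
  qed
  have int: "integrable (measure_pmf T) (\<lambda>t. ?R' k (c + L + min L t))"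
    by (intro integrable_pmf_bounded[where B = 1]) auto
  note integrable_pmf_indicator[simp] int[simp]
  have "a * ?R' (Suc k) (c + L) + ?b * (?R' (Suc k) (c + L) - a - real k * a)
     = (\<integral>t. indicator {L..} t * ?R' (Suc k) (c + L) + ?b * (?R' k (c + L + min L t) - indicator {L..} t - real k * a) \<partial>measure_pmf T)"
    unfolding measure_iid_sum_Suc[of ?T'] integral_map_pmf
    by (simp add: a_def)
  also have "\<dots> \<le> (\<integral>t. ?R (Suc k) (c + t) \<partial>measure_pmf T)"
  proof (rule integral_mono[OF _ _ pt])
    show "integrable (measure_pmf T) (\<lambda>t. ?R (Suc k) (c + t))"
      by (intro integrable_pmf_bounded[where B = 1]) auto
  qed (simp del: iid_sum.simps)
  also have "\<dots> = ?R (Suc (Suc k)) c" by (rule measure_iid_sum_Suc[symmetric])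
  finally have main: "a * ?R' (Suc k) (c + L) + ?b * (?R' (Suc k) (c + L) - a - real k * a) \<le> ?R (Suc (Suc k)) c" .
  have "real (Suc (Suc k)) * a * (?R' (Suc k) (c + L) - real (Suc k) * a)
      = a * ?R' (Suc k) (c + L) + ?b * (?R' (Suc k) (c + L) - a - real k * a) - a * (real (Suc k) * a)"
    by (simp add: algebra_simps)
  also have "\<dots> \<le> a * ?R' (Suc k) (c + L) + ?b * (?R' (Suc k) (c + L) - a - real k * a)"
    using a by simp
  finally show ?case using main by linarith
qed

section \<open>A bounded sum is not far below its mean\<close>

lemma expectation_iid_sum_Suc:
  fixes g :: "nat \<Rightarrow> real"
  assumes fin: "finite (set_pmf T)"
  shows "(\<integral>r. g r \<partial>iid_sum T (Suc k)) = (\<integral>t. (\<integral>r. g (t + r) \<partial>iid_sum T k) \<partial>T)"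
proof -
  have "(\<integral>r. g r \<partial>iid_sum T (Suc k)) = (\<Sum>t\<in>set_pmf T. pmf T t *\<^sub>R (\<integral>r. g (t + r) \<partial>iid_sum T k))"
    unfolding iid_sum.simps
    by (subst pmf_expectation_bind[OF fin]) (auto simp: set_pmf_iid_sum_finite fin)
  also have "\<dots> = (\<integral>t. (\<integral>r. g (t + r) \<partial>iid_sum T k) \<partial>T)"
    by (rule integral_measure_pmf[OF fin, symmetric])
  finally show ?thesis .
qed

lemma iid_sum_central_moments:
  fixes T :: "nat pmf"
  assumes fin: "finite (set_pmf T)"
  defines "\<mu> \<equiv> (\<integral>t. real t \<partial>T)"
  defines "m j \<equiv> (\<integral>t. (real t - \<mu>) ^ j \<partial>T)"
  shows "(\<integral>r. real r - real k * \<mu> \<partial>iid_sum T k) = 0"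
    and "(\<integral>r. (real r - real k * \<mu>)\<^sup>2 \<partial>iid_sum T k) = real k * m 2"
    and "(\<integral>r. (real r - real k * \<mu>) ^ 4 \<partial>iid_sum T k) = real k * m 4 + 3 * real k * (real k - 1) * (m 2)\<^sup>2"
proof -
  note [simp] = integrable_measure_pmf_finite[OF fin] integrable_measure_pmf_finite[OF set_pmf_iid_sum_finite[OF fin]]
  have m1: "(\<integral>t. real t - \<mu> \<partial>T) = 0" by (simp add: \<mu>_def)
  have A: "(\<integral>r. real r - real k * \<mu> \<partial>iid_sum T k) = 0" for k
  proof (induction k)
    case (Suc k)
    have "(\<integral>r. real r - real (Suc k) * \<mu> \<partial>iid_sum T (Suc k)) =
        (\<integral>t. (\<integral>r. (real t - \<mu>) + (real r - real k * \<mu>) \<partial>iid_sum T k) \<partial>T)"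
      unfolding expectation_iid_sum_Suc[OF fin] by (simp add: algebra_simps)
    also have "\<dots> = 0" by (subst Bochner_Integration.integral_add) (simp_all add: Suc m1 del: Bochner_Integration.integral_diff)
    finally show ?case .
  qed simp
  have B: "(\<integral>r. (real r - real k * \<mu>)\<^sup>2 \<partial>iid_sum T k) = real k * m 2" for k
  proof (induction k)
    case (Suc k)
    have in1: "(\<integral>r. (real t + real r - real (Suc k) * \<mu>)\<^sup>2 \<partial>iid_sum T k)
       = (real t - \<mu>)\<^sup>2 + real k * m 2" for t :: nat
    proof -
      have "(\<integral>r. (real t + real r - real (Suc k) * \<mu>)\<^sup>2 \<partial>iid_sum T k)
        = (\<integral>r. (real t - \<mu>)\<^sup>2 + 2 * (real t - \<mu>) * (real r - real k * \<mu>) + (real r - real k * \<mu>)\<^sup>2 \<partial>iid_sum T k)"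
        by (intro Bochner_Integration.integral_cong refl) (simp add: algebra_simps power2_eq_square)
      also have "\<dots> = (\<integral>r. (real t - \<mu>)\<^sup>2 \<partial>iid_sum T k) + 2 * (real t - \<mu>) * (\<integral>r. real r - real k * \<mu> \<partial>iid_sum T k)
          + (\<integral>r. (real r - real k * \<mu>)\<^sup>2 \<partial>iid_sum T k)"
        by (simp del: Bochner_Integration.integral_diff)
      finally show ?thesis unfolding A Suc by simp
    qed
    have "(\<integral>r. (real r - real (Suc k) * \<mu>)\<^sup>2 \<partial>iid_sum T (Suc k)) = (\<integral>t. (real t - \<mu>)\<^sup>2 + real k * m 2 \<partial>T)"
      unfolding expectation_iid_sum_Suc[OF fin] of_nat_add in1 ..
    also have "\<dots> = real (Suc k) * m 2" by (simp add: m_def algebra_simps)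
    finally show ?case .
  qed simp
  have C: "(\<integral>r. (real r - real k * \<mu>) ^ 4 \<partial>iid_sum T k) = real k * m 4 + 3 * real k * (real k - 1) * (m 2)\<^sup>2" for k
  proof (induction k)
    case (Suc k)
    define a3 where "a3 = (\<integral>r. (real r - real k * \<mu>) ^ 3 \<partial>iid_sum T k)"
    define a4 where "a4 = (\<integral>r. (real r - real k * \<mu>) ^ 4 \<partial>iid_sum T k)"
    have in1: "(\<integral>r. (real t + real r - real (Suc k) * \<mu>) ^ 4 \<partial>iid_sum T k)
       = (real t - \<mu>) ^ 4 + 6 * (real k * m 2) * (real t - \<mu>)\<^sup>2 + 4 * a3 * (real t - \<mu>) + a4" for t :: nat
    proof -
      have "(\<integral>r. (real t + real r - real (Suc k) * \<mu>) ^ 4 \<partial>iid_sum T k)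
        = (\<integral>r. (real t - \<mu>) ^ 4 + 4 * (real t - \<mu>) ^ 3 * (real r - real k * \<mu>)
            + 6 * (real t - \<mu>)\<^sup>2 * (real r - real k * \<mu>)\<^sup>2 + 4 * (real t - \<mu>) * (real r - real k * \<mu>) ^ 3
            + (real r - real k * \<mu>) ^ 4 \<partial>iid_sum T k)"
      proof (intro Bochner_Integration.integral_cong refl)
        fix r :: nat
        have "(u + w) ^ 4 = u ^ 4 + 4 * u ^ 3 * w + 6 * u\<^sup>2 * w\<^sup>2 + 4 * u * w ^ 3 + w ^ 4" for u w :: real
          by (simp add: algebra_simps power2_eq_square power3_eq_cube power4_eq_xxxx)
        from this[of "real t - \<mu>" "real r - real k * \<mu>"]
        show "(real t + real r - real (Suc k) * \<mu>) ^ 4 = (real t - \<mu>) ^ 4 + 4 * (real t - \<mu>) ^ 3 * (real r - real k * \<mu>)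
            + 6 * (real t - \<mu>)\<^sup>2 * (real r - real k * \<mu>)\<^sup>2 + 4 * (real t - \<mu>) * (real r - real k * \<mu>) ^ 3
            + (real r - real k * \<mu>) ^ 4" by (simp add: algebra_simps)
      qed
      also have "\<dots> = (\<integral>r. (real t - \<mu>) ^ 4 \<partial>iid_sum T k) + 4 * (real t - \<mu>) ^ 3 * (\<integral>r. real r - real k * \<mu> \<partial>iid_sum T k)
            + 6 * (real t - \<mu>)\<^sup>2 * (\<integral>r. (real r - real k * \<mu>)\<^sup>2 \<partial>iid_sum T k)
            + 4 * (real t - \<mu>) * a3 + a4"
        by (simp add: a3_def a4_def del: Bochner_Integration.integral_diff)
      finally show ?thesis unfolding A B by (simp add: mult_ac)
    qed
    have "(\<integral>r. (real r - real (Suc k) * \<mu>) ^ 4 \<partial>iid_sum T (Suc k))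
      = (\<integral>t. (real t - \<mu>) ^ 4 + 6 * (real k * m 2) * (real t - \<mu>)\<^sup>2 + 4 * a3 * (real t - \<mu>) + a4 \<partial>T)"
      unfolding expectation_iid_sum_Suc[OF fin] of_nat_add in1 ..
    also have "\<dots> = m 4 + 6 * (real k * m 2) * m 2 + 4 * a3 * (\<integral>t. real t - \<mu> \<partial>T) + a4"
      by (simp add: m_def del: Bochner_Integration.integral_diff)
    also have "\<dots> = real (Suc k) * m 4 + 3 * real (Suc k) * (real (Suc k) - 1) * (m 2)\<^sup>2"
      unfolding m1 a4_def Suc by (simp add: algebra_simps power2_eq_square)
    finally show ?case .
  qed simp
  show "(\<integral>r. real r - real k * \<mu> \<partial>iid_sum T k) = 0"
    and "(\<integral>r. (real r - real k * \<mu>)\<^sup>2 \<partial>iid_sum T k) = real k * m 2"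
    and "(\<integral>r. (real r - real k * \<mu>) ^ 4 \<partial>iid_sum T k) = real k * m 4 + 3 * real k * (real k - 1) * (m 2)\<^sup>2"
    by (rule A B C)+
qed

lemma chebyshev_lower:
  fixes W :: "'b \<Rightarrow> real"
  assumes fin: "finite (set_pmf P)" and h: "h > 0" and V: "(\<integral>x. (W x)\<^sup>2 \<partial>P) \<le> h\<^sup>2 / 2"
  shows "1 / 2 \<le> measure P {x. - h \<le> W x}"
proof -
  note [simp] = integrable_measure_pmf_finite[OF fin]
  have "1 - (W x)\<^sup>2 / h\<^sup>2 \<le> indicator {x. - h \<le> W x} x" for x
  proof (cases "- h \<le> W x")
    case False
    then have "h\<^sup>2 \<le> (- W x)\<^sup>2" using h by (intro power_mono) auto
    then show ?thesis using False h by (simp add: field_simps)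
  qed simp
  then have "(\<integral>x. 1 - (W x)\<^sup>2 / h\<^sup>2 \<partial>P) \<le> (\<integral>x. indicator {x. - h \<le> W x} x \<partial>P)"
    by (intro integral_mono) auto
  moreover have "(\<integral>x. (W x)\<^sup>2 \<partial>P) / h\<^sup>2 \<le> 1 / 2" using V h by (simp add: field_simps)
  ultimately show ?thesis by simp
qed

text \<open>
  In units of a suitable \<open>s\<close>, the polynomial \<open>(v + v\<^sup>2 - v\<^sup>4) / 2\<close> lies below the indicator of \<open>v \<ge> 0\<close>.
  Its expectation loses the linear term because the variable is centred, and the choice \<open>s\<^sup>2 = 2 C V\<close> makes the
  quartic term at most half of the quadratic one.
\<close>
lemma fourth_moment_lower:
  fixes W :: "'b \<Rightarrow> real"
  assumes fin: "finite (set_pmf P)" and mean: "(\<integral>x. W x \<partial>P) = 0"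
    and V: "(\<integral>x. (W x)\<^sup>2 \<partial>P) = V" "V > 0" and F: "(\<integral>x. (W x) ^ 4 \<partial>P) \<le> C * V\<^sup>2" and C: "C > 0"
  shows "1 / (8 * C) \<le> measure P {x. 0 \<le> W x}"
proof -
  note [simp] = integrable_measure_pmf_finite[OF fin]
  define s where "s = sqrt (2 * C * V)"
  have s: "s > 0" "s\<^sup>2 = 2 * C * V" using V C by (auto simp: s_def)
  have pt: "(W x / s + (W x / s)\<^sup>2 - (W x / s) ^ 4) / 2 \<le> indicator {x. 0 \<le> W x} x" for x
  proof -
    define v where "v = W x / s"
    have "v + v\<^sup>2 - v ^ 4 \<le> 2"
    proof -
      have "0 \<le> (v\<^sup>2 - 1)\<^sup>2 + (v - 1 / 2)\<^sup>2 + 1 / 4" by (intro add_nonneg_nonneg) auto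
      moreover have "(v\<^sup>2 - 1)\<^sup>2 + (v - 1 / 2)\<^sup>2 = v ^ 4 - v\<^sup>2 - v + 5 / 4"
        by (simp add: power2_eq_square power4_eq_xxxx algebra_simps)
      ultimately show ?thesis by linarith
    qed
    moreover have "v + v\<^sup>2 - v ^ 4 \<le> 0" if "v < 0"
    proof -
      define w where "w = - v"
      have w: "w > 0" using that by (simp add: w_def)
      have "w - w ^ 3 \<le> 1"
      proof (cases "w \<le> 1")
        case True
        then show ?thesis using w by (smt (verit) zero_less_power)
      next
        case False
        then have "w ^ 1 \<le> w ^ 3" by (intro power_increasing) auto
        then show ?thesis by simp
      qed
      then have "w * (w - w ^ 3) \<le> w * 1" using w by (intro mult_left_mono) auto
      then show ?thesis by (simp add: w_def power2_eq_square power3_eq_cube power4_eq_xxxx algebra_simps)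
    qed
    moreover have "v < 0 \<longleftrightarrow> W x < 0" using s by (simp add: v_def divide_less_0_iff)
    ultimately show ?thesis unfolding v_def[symmetric] by (auto simp: indicator_def not_le)
  qed
  have "(\<integral>x. (W x / s + (W x / s)\<^sup>2 - (W x / s) ^ 4) / 2 \<partial>P)
     = ((\<integral>x. W x \<partial>P) / s + (\<integral>x. (W x)\<^sup>2 \<partial>P) / s\<^sup>2 - (\<integral>x. (W x) ^ 4 \<partial>P) / s ^ 4) / 2"
    by (simp add: power_divide)
  also have "\<dots> = (1 / (2 * C) - (\<integral>x. (W x) ^ 4 \<partial>P) / s ^ 4) / 2"
    using V C unfolding mean s(2) by simp
  also have "\<dots> \<ge> (1 / (2 * C) - 1 / (4 * C)) / 2"
  proof -
    have "s ^ 4 = (s\<^sup>2)\<^sup>2" by simp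
    also have "\<dots> = 4 * C\<^sup>2 * V\<^sup>2" by (simp add: s power_mult_distrib)
    finally have s4: "s ^ 4 = 4 * C\<^sup>2 * V\<^sup>2" .
    have "(\<integral>x. (W x) ^ 4 \<partial>P) / s ^ 4 \<le> C * V\<^sup>2 / s ^ 4"
      using F s by (intro divide_right_mono) auto
    also have "\<dots> = 1 / (4 * C)" unfolding s4 using V C by (simp add: field_simps power2_eq_square)
    finally show ?thesis by simp
  qed
  finally have "(1 / (2 * C) - 1 / (4 * C)) / 2 \<le> (\<integral>x. (W x / s + (W x / s)\<^sup>2 - (W x / s) ^ 4) / 2 \<partial>P)" .
  also have "\<dots> \<le> (\<integral>x. indicator {x. 0 \<le> W x} x \<partial>P)"
    by (intro integral_mono pt) auto
  finally show ?thesis by (simp add: field_simps)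
qed

text \<open>
  The constant does not depend on the law of the summands nor on \<open>k\<close>. A small variance is handled by
  \<open>chebyshev_lower\<close>; a variance \<open>V \<ge> b\<^sup>2 / 32\<close> makes the bound \<open>b\<close> on the summands comparable with the
  standard deviation, so that the fourth central moment is at most \<open>(32 + 3) V\<^sup>2\<close>, whence \<open>280 = 8 * 35\<close>.
\<close>
lemma bounded_iid_sum_not_far_below_mean:
  fixes T :: "nat pmf" and b :: real
  assumes fin: "finite (set_pmf T)" and b: "b > 0"
  defines "\<mu> \<equiv> (\<integral>t. real t \<partial>T)"
  assumes bd: "\<And>t. t \<in> set_pmf T \<Longrightarrow> \<bar>real t - \<mu>\<bar> \<le> b"
  shows "1 / 280 \<le> measure (iid_sum T k) {r. real k * \<mu> - b / 4 \<le> real r}"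
proof -
  note [simp] = integrable_measure_pmf_finite[OF fin]
  let ?P = "iid_sum T k"
  let ?W = "\<lambda>r. real r - real k * \<mu>"
  define m where "m j = (\<integral>t. (real t - \<mu>) ^ j \<partial>T)" for j
  define V where "V = real k * m 2"
  note finP = set_pmf_iid_sum_finite[OF fin, of k]
  note mom = iid_sum_central_moments[OF fin, of k, folded \<mu>_def, folded m_def, folded V_def]
  have m2: "m 2 \<ge> 0" by (simp add: m_def)
  have set: "{r. real k * \<mu> - b / 4 \<le> real r} = {r. - (b / 4) \<le> ?W r}" by auto
  show ?thesis
  proof (cases "V \<le> (b / 4)\<^sup>2 / 2")
    case True
    have "1 / 2 \<le> measure ?P {r. - (b / 4) \<le> ?W r}"
      using b True mom(2) by (intro chebyshev_lower finP) auto
    then show ?thesis unfolding set by linarith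
  next
    case False
    then have Vb: "b\<^sup>2 \<le> 32 * V" by (simp add: power_divide)
    have Vpos: "V > 0" using False b by (smt (verit) zero_le_power2 divide_nonneg_nonneg)
    have "m 4 \<le> (\<integral>t. b\<^sup>2 * (real t - \<mu>)\<^sup>2 \<partial>T)"
      unfolding m_def
    proof (rule integral_mono_AE)
      show "AE t in T. (real t - \<mu>) ^ 4 \<le> b\<^sup>2 * (real t - \<mu>)\<^sup>2"
      proof (rule AE_pmfI)
        fix t assume "t \<in> set_pmf T"
        then have "(real t - \<mu>)\<^sup>2 \<le> b\<^sup>2" using bd b by (simp add: abs_le_square_iff[symmetric])
        then have "(real t - \<mu>)\<^sup>2 * (real t - \<mu>)\<^sup>2 \<le> b\<^sup>2 * (real t - \<mu>)\<^sup>2" by (intro mult_right_mono) auto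
        then show "(real t - \<mu>) ^ 4 \<le> b\<^sup>2 * (real t - \<mu>)\<^sup>2" by (simp add: power2_eq_square power4_eq_xxxx mult_ac)
      qed
    qed auto
    also have "\<dots> = b\<^sup>2 * m 2" by (simp add: m_def)
    finally have "real k * m 4 \<le> real k * (b\<^sup>2 * m 2)" by (intro mult_left_mono) auto
    also have "\<dots> = b\<^sup>2 * V" by (simp add: V_def)
    also have "\<dots> \<le> 32 * V * V" using Vb Vpos by (intro mult_right_mono) auto
    finally have k4: "real k * m 4 \<le> 32 * V\<^sup>2" by (simp add: power2_eq_square)
    have "3 * real k * (real k - 1) * (m 2)\<^sup>2 \<le> 3 * real k * real k * (m 2)\<^sup>2"
      by (intro mult_right_mono mult_left_mono) auto
    also have "\<dots> = 3 * V\<^sup>2" by (simp add: V_def power2_eq_square)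
    finally have "(\<integral>r. (?W r) ^ 4 \<partial>?P) \<le> 35 * V\<^sup>2" using k4 mom(3) by linarith
    then have "1 / (8 * 35) \<le> measure ?P {r. 0 \<le> ?W r}"
      by (intro fourth_moment_lower[where V = V] finP mom Vpos) auto
    also have "\<dots> \<le> measure ?P {r. - (b / 4) \<le> ?W r}"
      using b by (intro measure_pmf.finite_measure_mono) auto
    finally show ?thesis unfolding set by simp
  qed
qed

section \<open>Tails of the jump law and of the invariant law\<close>

lemma powr_tail_le:
  assumes s: "s > 0" and m: "m \<ge> 1"
  shows "(\<Sum>i. 1 / real (m + i) powr (s + 1)) \<le> 2 powr (s + 1) / s * real m powr (- s)"
proof -
  let ?a = "\<lambda>i. real (m + i) powr (- s)"
  have lim: "?a \<longlonglongrightarrow> 0"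
    using s by real_asymp
  have tel: "(\<lambda>i. ?a i - ?a (Suc i)) sums real m powr (- s)"
    using telescope_sums'[OF lim] by simp
  \<comment> \<open>By the mean value theorem the decrements of \<open>u powr (- s)\<close> dominate the summands; the factor
    \<open>2 powr (s + 1)\<close> compensates for evaluating at \<open>z \<le> 2 * u\<close> instead of \<open>u\<close>.\<close>
  have pt: "1 / real (m + i) powr (s + 1) \<le> 2 powr (s + 1) / s * (?a i - ?a (Suc i))" for i
  proof -
    define u where "u = real (m + i)"
    have u: "u \<ge> 1" using m by (simp add: u_def)
    have "\<exists>z>u. z < u + 1 \<and> (u + 1) powr (- s) - u powr (- s) = (u + 1 - u) * ((- s) * z powr (- s - 1))"
      using u by (intro MVT2) (auto intro!: derivative_eq_intros)
    then obtain z where z: "u < z" "z < u + 1" "(u + 1) powr (- s) - u powr (- s) = - s * z powr (- s - 1)"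
      by auto
    have "(2 * u) powr (- s - 1) \<le> z powr (- s - 1)"
      using z u s by (intro powr_mono2') auto
    then have "s * (2 * u) powr (- s - 1) \<le> s * z powr (- s - 1)"
      using s by (intro mult_left_mono) auto
    also have "\<dots> = u powr (- s) - (u + 1) powr (- s)"
      using z(3) by simp
    finally have "s * (2 powr (- s - 1) * u powr (- s - 1)) \<le> u powr (- s) - (u + 1) powr (- s)"
      using u by (simp only: powr_mult)
    then have "2 powr (s + 1) / s * (s * (2 powr (- s - 1) * u powr (- s - 1))) \<le> 2 powr (s + 1) / s * (u powr (- s) - (u + 1) powr (- s))"
      using s by (intro mult_left_mono) auto
    moreover have "2 powr (s + 1) / s * (s * (2 powr (- s - 1) * u powr (- s - 1))) = (2 powr (s + 1) * 2 powr (- s - 1)) * u powr (- s - 1)"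
      using s by simp
    moreover have "2 powr (s + 1) * 2 powr (- s - 1) = (1::real)"
      by (simp flip: powr_add)
    moreover have "u powr (- s - 1) = 1 / u powr (s + 1)"
      using powr_minus_divide[of u "s + 1"] by simp
    moreover have "real (m + Suc i) = u + 1" by (simp add: u_def)
    ultimately show ?thesis unfolding u_def by (simp only: mult_1)
  qed
  have "(\<Sum>i. 1 / real (m + i) powr (s + 1)) \<le> (\<Sum>i. 2 powr (s + 1) / s * (?a i - ?a (Suc i)))"
    using s by (intro suminf_le pt summable_powr_shift summable_mult sums_summable[OF tel]) auto
  also have "\<dots> = 2 powr (s + 1) / s * real m powr (- s)"
    using sums_mult[OF tel, of "2 powr (s + 1) / s"] by (rule sums_unique[symmetric])
  finally show ?thesis .
qed

lemma powr_tail_ge: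
  assumes s: "s > 0" and m: "m \<ge> 1"
  shows "2 powr (- s - 1) * real m powr (- s) \<le> (\<Sum>i. 1 / real (m + i) powr (s + 1))"
proof -
  have m0: "real m > 0" using m by simp
  \<comment> \<open>The first \<open>m\<close> summands already suffice: each has its base at most \<open>2 * m\<close>.\<close>
  have "2 powr (- s - 1) * real m powr (- s) = (\<Sum>i<m. (2 * real m) powr (- s - 1))"
    using m0 powr_add[of "real m" 1 "- s - 1"] by (simp add: powr_mult)
  also have "\<dots> \<le> (\<Sum>i<m. 1 / real (m + i) powr (s + 1))"
  proof (rule sum_mono)
    fix i assume "i \<in> {..<m}"
    then have "(2 * real m) powr (- (s + 1)) \<le> real (m + i) powr (- (s + 1))"
      using s m0 by (intro powr_mono2') auto
    then show "(2 * real m) powr (- s - 1) \<le> 1 / real (m + i) powr (s + 1)"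
      using powr_minus_divide[of "real (m + i)" "s + 1"] by simp
  qed
  also have "\<dots> \<le> (\<Sum>i. 1 / real (m + i) powr (s + 1))"
    using s by (intro sum_le_suminf summable_powr_shift) auto
  finally show ?thesis .
qed

text \<open>
  Stationarity balances the flow into \<open>{j + 1, j + 2, \<dots>}\<close>, which consists of jumps from \<open>0\<close>, with the flow out
  of it, which leaves through \<open>j + 1\<close>.
\<close>
lemma pmf_0_mult_tail_jump:
  assumes p: "p > 0" and inv: "bind_pmf \<pi> (jump_kernel p) = \<pi>"
  shows "pmf \<pi> 0 * measure (jump_kernel p 0) {Suc j..} = pmf \<pi> (Suc j)"
proof -
  let ?J = "jump_kernel p 0"
  have "measure \<pi> {Suc j..} = (\<integral>y. measure (jump_kernel p y) {Suc j..} \<partial>\<pi>)"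
    using measure_bind_pmf_eq_expectation[of \<pi> "jump_kernel p" "{Suc j..}"] inv by simp
  also have "\<dots> = (\<integral>y. measure ?J {Suc j..} * indicator {0} y + indicator {Suc (Suc j)..} y \<partial>\<pi>)"
    by (intro Bochner_Integration.integral_cong refl) (auto simp: jump_kernel_def indicator_def)
  also have "\<dots> = measure ?J {Suc j..} * pmf \<pi> 0 + measure \<pi> {Suc (Suc j)..}"
    by (subst Bochner_Integration.integral_add)
       (auto simp: integrable_pmf_indicator measure_pmf_single)
  finally have "measure \<pi> {Suc j..} = measure ?J {Suc j..} * pmf \<pi> 0 + measure \<pi> {Suc (Suc j)..}" .
  moreover have "measure \<pi> {Suc j..} = measure \<pi> {Suc j} + measure \<pi> {Suc (Suc j)..}"
  proof -
    have "{Suc j..} = {Suc j} \<union> {Suc (Suc j)..}" by auto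
    then show ?thesis by (simp only:) (rule measure_pmf.finite_measure_Union, auto)
  qed
  ultimately show ?thesis by (simp add: measure_pmf_single mult.commute)
qed

text \<open>
  A truncated form of Kac's formula, which says that \<open>q\<close> times the mean return time is \<open>1\<close>. The defect caused
  by truncation is exactly a tail of \<open>\<pi>\<close>. It follows by writing the truncated jump as a sum of
  indicators of tails.
\<close>
lemma pmf_0_mult_truncated_return_mean:
  assumes p: "p > 0" and inv: "bind_pmf \<pi> (jump_kernel p) = \<pi>"
  shows "pmf \<pi> 0 * (\<integral>t. real t \<partial>map_pmf (min (Suc B)) (map_pmf Suc (jump_kernel p 0)))
    = 1 - measure \<pi> {Suc B..}"
proof -
  let ?J = "jump_kernel p 0"
  have layer: "real (min (Suc B) (Suc j)) = 1 + (\<Sum>i<B. indicator {Suc i..} j)" for j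
  proof -
    have "(\<Sum>i<B. indicator {Suc i..} j :: real) = (\<Sum>i\<in>{..<min B j}. 1)"
      by (rule sum.mono_neutral_cong_right) (auto simp: indicator_def)
    then show ?thesis by simp
  qed
  have "(\<integral>t. real t \<partial>map_pmf (min (Suc B)) (map_pmf Suc ?J)) = (\<integral>j. 1 + (\<Sum>i<B. indicator {Suc i..} j) \<partial>?J)"
    by (simp only: integral_map_pmf layer)
  also have "\<dots> = 1 + (\<Sum>i<B. measure ?J {Suc i..})"
    by (simp add: integrable_pmf_indicator)
  finally have "pmf \<pi> 0 * (\<integral>t. real t \<partial>map_pmf (min (Suc B)) (map_pmf Suc ?J))
     = pmf \<pi> 0 + (\<Sum>i<B. pmf \<pi> (Suc i))"
    by (simp add: distrib_left sum_distrib_left pmf_0_mult_tail_jump[OF p inv])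
  also have "\<dots> = (\<Sum>i<Suc B. pmf \<pi> i)" by (simp only: sum.lessThan_Suc_shift)
  also have "\<dots> = measure \<pi> {..<Suc B}" by (simp add: measure_measure_pmf_finite)
  also have "\<dots> = 1 - measure \<pi> {Suc B..}"
    using measure_pmf.prob_compl[of "{Suc B..}" \<pi>] by (simp add: Compl_eq_Diff_UNIV[symmetric] Compl_atLeast)
  finally show ?thesis .
qed

lemma invariant_bounds:
  assumes p: "p > 1" and inv: "bind_pmf \<pi> (jump_kernel p) = \<pi>"
  obtains c C where "c > 0" "C > 0" "pmf \<pi> 0 > 0"
    "\<And>m. m \<ge> 1 \<Longrightarrow> c * real m powr (- p) \<le> measure (jump_kernel p 0) {m..}"
    "\<And>m. m \<ge> 1 \<Longrightarrow> measure (jump_kernel p 0) {m..} \<le> C * real m powr (- p)"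
    "\<And>m. m \<ge> 1 \<Longrightarrow> measure \<pi> {m..} \<le> C * real m powr (1 - p)"
proof -
  have p0: "p > 0" using p by simp
  obtain d where d: "d > 0" "\<And>n. n > 0 \<Longrightarrow> pmf \<pi> n = (\<Sum>i. d / real (n + i) powr (p + 1))" "pmf \<pi> 0 = pmf \<pi> 1"
    using inv unfolding jump_kernel_invariant_iff[OF p] by blast
  define S where "S n = (\<Sum>i. 1 / real (n + i) powr (p + 1))" for n
  have \<pi>S: "pmf \<pi> n = d * S n" if "n > 0" for n
    unfolding d(2)[OF that] S_def using suminf_mult[OF summable_powr_shift[of "p + 1" 1 n], of d] p by simp
  let ?l = "2 powr (- p - 1) :: real" and ?u = "2 powr (p + 1) / p :: real"
  have lo: "?l * real m powr (- p) \<le> S m" and up: "S m \<le> ?u * real m powr (- p)" if "m \<ge> 1" for m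
    using powr_tail_ge[OF p0 that] powr_tail_le[OF p0 that] by (simp_all add: S_def)
  have q: "pmf \<pi> 0 > 0"
  proof -
    have "0 < d * (?l * real 1 powr (- p))" using d(1) by simp
    also have "\<dots> \<le> d * S 1" using lo[of 1] d(1) by (intro mult_left_mono) auto
    finally show ?thesis using \<pi>S[of 1] d(3) by simp
  qed
  let ?q = "pmf \<pi> 0"
  have J: "measure (jump_kernel p 0) {m..} = d / ?q * S m" if "m \<ge> 1" for m
    using pmf_0_mult_tail_jump[OF p0 inv, of "m - 1"] that q \<pi>S[of m] by (simp add: field_simps)
  have tail\<pi>: "measure \<pi> {m..} \<le> d * ?u * (2 powr p / (p - 1)) * real m powr (1 - p)" if m: "m \<ge> 1" for m
  proof -
    have "(\<lambda>i. measure \<pi> {m + i}) sums measure \<pi> (\<Union>i. {m + i})"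
      by (rule measure_pmf.finite_measure_UNION) (auto simp: disjoint_family_on_def)
    moreover have "(\<Union>i. {m + i}) = {m..}" by (auto intro: le_add_diff_inverse[symmetric])
    ultimately have s: "(\<lambda>i. pmf \<pi> (m + i)) sums measure \<pi> {m..}" by (simp add: measure_pmf_single)
    have sm: "summable (\<lambda>i. 1 / real (m + i) powr (p - 1 + 1))" using p by (intro summable_powr_shift) auto
    have "measure \<pi> {m..} = (\<Sum>i. pmf \<pi> (m + i))" using s by (simp add: sums_iff)
    also have "\<dots> \<le> (\<Sum>i. d * ?u * (1 / real (m + i) powr (p - 1 + 1)))"
    proof (intro suminf_le sums_summable[OF s] summable_mult sm)
      fix i
      have "pmf \<pi> (m + i) = d * S (m + i)" using m by (intro \<pi>S) auto
      also have "\<dots> \<le> d * (?u * real (m + i) powr (- p))"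
        using m d(1) by (intro mult_left_mono up) auto
      also have "\<dots> = d * ?u * (1 / real (m + i) powr (p - 1 + 1))" by (simp add: powr_minus_divide)
      finally show "pmf \<pi> (m + i) \<le> d * ?u * (1 / real (m + i) powr (p - 1 + 1))" .
    qed
    also have "\<dots> = d * ?u * (\<Sum>i. 1 / real (m + i) powr (p - 1 + 1))" by (rule suminf_mult[OF sm])
    also have "\<dots> \<le> d * ?u * (2 powr (p - 1 + 1) / (p - 1) * real m powr (- (p - 1)))"
      using d(1) p m by (intro mult_left_mono powr_tail_le) auto
    finally show ?thesis by (simp add: mult.assoc)
  qed
  define c where "c = d / ?q * ?l"
  define C1 where "C1 = d / ?q * ?u"
  define C2 where "C2 = d * ?u * (2 powr p / (p - 1))"
  have C: "c > 0" "C1 > 0" "C2 > 0" using d(1) q p by (simp_all add: c_def C1_def C2_def)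
  show thesis
  proof (rule that[of c "C1 + C2"])
    fix m :: nat assume m: "m \<ge> 1"
    have dq: "d / ?q \<ge> 0" using d(1) q by simp
    show "c * real m powr (- p) \<le> measure (jump_kernel p 0) {m..}"
      unfolding J[OF m] c_def mult.assoc by (intro mult_left_mono lo m dq)
    have "measure (jump_kernel p 0) {m..} \<le> C1 * real m powr (- p)"
      unfolding J[OF m] C1_def mult.assoc by (intro mult_left_mono up[unfolded mult.assoc] m dq)
    also have "\<dots> \<le> (C1 + C2) * real m powr (- p)" using C by (intro mult_right_mono) auto
    finally show "measure (jump_kernel p 0) {m..} \<le> (C1 + C2) * real m powr (- p)" .
    have "measure \<pi> {m..} \<le> C2 * real m powr (1 - p)" using tail\<pi>[OF m] by (simp add: C2_def)
    also have "\<dots> \<le> (C1 + C2) * real m powr (1 - p)" using C by (intro mult_right_mono) auto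
    finally show "measure \<pi> {m..} \<le> (C1 + C2) * real m powr (1 - p)" .
  qed (use C q in auto)
qed

section \<open>The lower bound\<close>

lemma prob_centered_sum_ge:
  assumes M: "prob_space M" and chain: "markov_chain M \<pi> (jump_kernel p) Y"
    and k: "real k \<le> real n * pmf \<pi> 0 - x"
  shows "measure (iid_sum (map_pmf Suc (jump_kernel p 0)) k) {r. n \<le> r} \<le>
    \<P>(\<omega> in M. (\<Sum>i<n. centered_indicator \<pi> (Y i \<omega>)) \<ge> x)"
proof -
  interpret prob_space M by (rule M)
  note [measurable] = measurable_chain[OF M chain]
  have [measurable]: "(\<lambda>\<omega>. centered_indicator \<pi> (Y i \<omega>)) \<in> borel_measurable M" for i
    by (rule measurable_compose[OF measurable_chain[OF M chain]]) simp
  have "measure (iid_sum (map_pmf Suc (jump_kernel p 0)) k) {r. n \<le> r} \<le>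
     prob {\<omega>\<in>space M. (\<Sum>i<n. of_bool (Y i \<omega> = 0)) \<le> k}"
    by (rule prob_few_visits_ge[OF M chain])
  also have "\<dots> \<le> prob {\<omega>\<in>space M. (\<Sum>i<n. centered_indicator \<pi> (Y i \<omega>)) \<ge> x}"
  proof (rule finite_measure_mono)
    show "{\<omega>\<in>space M. (\<Sum>i<n. of_bool (Y i \<omega> = 0)) \<le> k} \<subseteq> {\<omega>\<in>space M. (\<Sum>i<n. centered_indicator \<pi> (Y i \<omega>)) \<ge> x}"
    proof safe
      fix \<omega> assume "(\<Sum>i<n. of_bool (Y i \<omega> = 0)) \<le> k"
      then have "real (\<Sum>i<n. of_bool (Y i \<omega> = 0)) \<le> real k" by (rule of_nat_mono)
      moreover have "(\<Sum>i<n. centered_indicator \<pi> (Y i \<omega>)) = real n * pmf \<pi> 0 - real (\<Sum>i<n. of_bool (Y i \<omega> = 0))"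
      proof -
        have "centered_indicator \<pi> y = pmf \<pi> 0 - real (of_bool (y = 0))" for y
          by (simp add: centered_indicator_def)
        then show ?thesis by (simp add: sum_subtractf)
      qed
      ultimately show "x \<le> (\<Sum>i<n. centered_indicator \<pi> (Y i \<omega>))" using k by linarith
    qed
  qed measurable
  finally show ?thesis .
qed

text \<open>
  If one return time has already supplied \<open>B + 1\<close>, the remaining ones may fall short of \<open>n\<close> by that much. Their
  truncated mean misses \<open>n\<close> by at most \<open>3 B / 4\<close>, by the hypothesis \<open>small\<close> and Kac's formula, and the
  last quarter of \<open>B\<close> absorbs the downward fluctuation.
\<close>
lemma prob_returns_without_big_jump_ge:
  fixes k n B :: nat and y :: real
  assumes p: "p > 0" and inv: "bind_pmf \<pi> (jump_kernel p) = \<pi>" and q: "pmf \<pi> 0 > 0" and B: "B \<ge> 1"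
    and k: "real n * pmf \<pi> 0 - y \<le> real k" "y \<ge> 0"
    and small: "real n * measure \<pi> {Suc B..} + y / pmf \<pi> 0 \<le> 3 / 4 * real B"
  shows "1 / 280 \<le> measure (iid_sum (map_pmf (min (Suc B)) (map_pmf Suc (jump_kernel p 0))) k) {r. n \<le> Suc B + r}"
proof -
  let ?T = "map_pmf (min (Suc B)) (map_pmf Suc (jump_kernel p 0))"
  let ?q = "pmf \<pi> 0"
  let ?e = "measure \<pi> {Suc B..}"
  define \<mu> where "\<mu> = (\<integral>t. real t \<partial>?T)"
  have set: "set_pmf ?T \<subseteq> {1..Suc B}" by auto
  then have fin: "finite (set_pmf ?T)" by (rule finite_subset) simp
  note int = integrable_measure_pmf_finite[OF fin]
  have \<mu>q: "?q * \<mu> = 1 - ?e"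
    unfolding \<mu>_def by (rule pmf_0_mult_truncated_return_mean[OF p inv])
  have "1 \<le> \<mu>" unfolding \<mu>_def
    using set by (intro measure_pmf.integral_ge_const int AE_pmfI) fastforce
  moreover have "\<mu> \<le> real (Suc B)" unfolding \<mu>_def
    using set by (intro measure_pmf.integral_le_const int AE_pmfI) fastforce
  ultimately have bd: "\<bar>real t - \<mu>\<bar> \<le> real B" if "t \<in> set_pmf ?T" for t
  proof -
    have "1 \<le> t" "t \<le> Suc B" using that set by auto
    then have "1 \<le> real t" "real t \<le> real B + 1" by auto
    then show ?thesis using \<open>1 \<le> \<mu>\<close> \<open>\<mu> \<le> real (Suc B)\<close> by auto
  qed
  have "?q * \<mu> \<le> 1" unfolding \<mu>q by simp
  then have \<mu>le: "\<mu> \<le> 1 / ?q" using q by (simp add: field_simps)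
  have "real n - 3 / 4 * real B \<le> real n - real n * ?e - y / ?q" using small by linarith
  also have "\<dots> \<le> real n * (?q * \<mu>) - y * \<mu>"
    using mult_left_mono[OF \<mu>le k(2)] unfolding \<mu>q by (simp add: algebra_simps)
  also have "\<dots> = (real n * ?q - y) * \<mu>" by (simp add: algebra_simps)
  also have "\<dots> \<le> real k * \<mu>" using k \<open>1 \<le> \<mu>\<close> by (intro mult_right_mono) auto
  finally have n: "real n \<le> real k * \<mu> + 3 / 4 * real B" by linarith
  have "1 / 280 \<le> measure (iid_sum ?T k) {r. real k * \<mu> - real B / 4 \<le> real r}"
    unfolding \<mu>_def by (rule bounded_iid_sum_not_far_below_mean[OF fin]) (use B bd in \<open>auto simp: \<mu>_def\<close>)
  also have "\<dots> \<le> measure (iid_sum ?T k) {r. n \<le> Suc B + r}"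
  proof (rule measure_pmf.finite_measure_mono)
    show "{r. real k * \<mu> - real B / 4 \<le> real r} \<subseteq> {r. n \<le> Suc B + r}"
    proof safe
      fix r :: nat assume "real k * \<mu> - real B / 4 \<le> real r"
      then have "real n \<le> real (Suc B + r)" using n by simp
      then show "n \<le> Suc B + r" by (simp only: of_nat_le_iff)
    qed
  qed simp
  finally show ?thesis .
qed

theorem proposition4p1:
  fixes p :: real and M :: "'a measure" and Y :: "nat \<Rightarrow> 'a \<Rightarrow> nat" and \<pi> :: "nat pmf"
  assumes "p > 1"
    and "bind_pmf \<pi> (jump_kernel p) = \<pi>"
    and "prob_space M"
    and "markov_chain M \<pi> (jump_kernel p) Y"
  shows "\<exists>\<kappa>>0. \<forall>n\<ge>1. \<forall>x\<in>{\<kappa> * real n powr (1 / p) .. real n / \<kappa>}.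
    \<P>(\<omega> in M. (\<Sum>i<n. centered_indicator \<pi> (Y i \<omega>)) \<ge> x) \<ge> (1 / \<kappa>) * (real n / x powr p)"
proof -
  note p = \<open>p > 1\<close>
  have p0: "p > 0" using p by simp
  obtain c C where c: "c > 0" and C: "C > 0" and q: "pmf \<pi> 0 > 0"
    and Jlo: "\<And>m. m \<ge> 1 \<Longrightarrow> c * real m powr (- p) \<le> measure (jump_kernel p 0) {m..}"
    and Jup: "\<And>m. m \<ge> 1 \<Longrightarrow> measure (jump_kernel p 0) {m..} \<le> C * real m powr (- p)"
    and \<pi>up: "\<And>m. m \<ge> 1 \<Longrightarrow> measure \<pi> {m..} \<le> C * real m powr (1 - p)"
    using invariant_bounds[OF assms(1,2)] by blast
  define q where "q = pmf \<pi> 0"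
  have q: "q > 0" "q \<le> 1" using q by (simp_all add: q_def pmf_le_1)
  \<comment> \<open>\<open>D\<close> collects the factors lost below: half of the \<open>n q\<close> returns, the tail constant \<open>c\<close> at
    \<open>5 * x / q\<close>, and the probability \<open>1 / 560\<close> left after the correction for several large jumps.\<close>
  define D where "D = q * c * (5 / q) powr (- p) / 1120"
  have D: "D > 0" using q c by (simp add: D_def)
  define \<kappa> where "\<kappa> = 1 / D + 4 / q + 560 * C + 2"
  have pos: "1 / D > 0" "4 / q > 0" using D q by simp_all
  have \<kappa>: "1 / D \<le> \<kappa>" "4 / q \<le> \<kappa>" "560 * C \<le> \<kappa>" "2 \<le> \<kappa>"
    using pos C unfolding \<kappa>_def by linarith+
  have \<kappa>0: "\<kappa> > 0" using \<kappa> by linarith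
  have main: "(1 / \<kappa>) * (real n / x powr p) \<le> \<P>(\<omega> in M. (\<Sum>i<n. centered_indicator \<pi> (Y i \<omega>)) \<ge> x)"
    if n: "n \<ge> 1" and x: "\<kappa> * real n powr (1 / p) \<le> x" "x \<le> real n / \<kappa>" for n x
  proof -
    have "1 \<le> real n powr (1 / p)" using n p by (intro ge_one_powr_ge_zero) auto
    then have "\<kappa> * 1 \<le> \<kappa> * real n powr (1 / p)" using \<kappa>0 by (intro mult_left_mono) auto
    then have x\<kappa>: "\<kappa> \<le> x" using x by linarith
    have x2: "x \<ge> 2" using x\<kappa> \<kappa> by linarith
    \<comment> \<open>All error terms are small through \<open>n / x powr p \<le> 1 / \<kappa>\<close>.\<close>
    have \<kappa>p: "\<kappa> * real n \<le> x powr p"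
    proof -
      have "\<kappa> * real n \<le> \<kappa> powr p * real n"
        using powr_mono[of 1 p \<kappa>] p \<kappa> by (intro mult_right_mono) auto
      also have "\<dots> = (\<kappa> * real n powr (1 / p)) powr p"
        using p0 \<kappa>0 by (simp add: powr_mult powr_powr)
      also have "\<dots> \<le> x powr p" using x \<kappa>0 p0 by (intro powr_mono2) auto
      finally show ?thesis .
    qed
    \<comment> \<open>A return time above \<open>4 * x / q\<close> covers the deficit \<open>x / q\<close> of the mean with room to spare for rounding,
      truncation and fluctuations.\<close>
    define B where "B = nat \<lceil>4 * x / q\<rceil>"
    have xq: "x \<le> x / q" using q x2 by (simp add: field_simps)
    have B: "4 * x / q \<le> real B" "real B \<le> 5 * x / q"
    proof -
      have "0 \<le> 4 * x / q" using q x2 by simp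
      then have "real B = of_int \<lceil>4 * x / q\<rceil>" by (simp add: B_def)
      moreover have "5 * x / q = 4 * x / q + x / q" by (simp add: field_simps)
      ultimately show "4 * x / q \<le> real B" "real B \<le> 5 * x / q" using xq x2 by linarith+
    qed
    have Bx: "x \<le> real B"
    proof -
      have "4 * x / q = 4 * (x / q)" by simp
      then show ?thesis using B(1) xq x2 by linarith
    qed
    have B1: "B \<ge> 1" using Bx x2 by linarith
    have Bp: "real n * real B powr (- p) \<le> 1 / \<kappa>"
    proof -
      have "real B powr (- p) \<le> x powr (- p)" using Bx x2 p0 by (intro powr_mono2') auto
      then have "real n * real B powr (- p) \<le> real n * x powr (- p)" by (intro mult_left_mono) auto
      also have "\<dots> \<le> 1 / \<kappa>" using \<kappa>p x2 \<kappa>0 by (simp add: powr_minus_divide field_simps)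
      finally show ?thesis .
    qed
    have C\<kappa>: "C * (1 / \<kappa>) \<le> 1 / 560" using \<kappa>(3) \<kappa>0 by (simp add: field_simps)
    \<comment> \<open>The upper bound on \<open>x\<close> keeps at least half of the expected \<open>n q\<close> returns.\<close>
    have nq: "x \<le> real n * q / 4" "1 \<le> real n * q / 4"
    proof -
      have "4 \<le> \<kappa> * q" using \<kappa>(2) q by (simp add: field_simps)
      then have "x * 4 \<le> x * (\<kappa> * q)" using x2 by (intro mult_left_mono) auto
      also have "\<dots> = (x * \<kappa>) * q" by simp
      also have "\<dots> \<le> real n * q" using x(2) \<kappa>0 q by (intro mult_right_mono) (auto simp: field_simps)
      finally show "x \<le> real n * q / 4" by simp
      then show "1 \<le> real n * q / 4" using x2 by linarith
    qed
    \<comment> \<open>One of the \<open>\<lfloor>n q - x\<rfloor>\<close> returns is reserved for the large jump, so \<open>k\<close> counts the others.\<close>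
    define k where "k = nat \<lfloor>real n * q - x\<rfloor> - 1"
    have fl: "\<lfloor>real n * q - x\<rfloor> \<ge> 1" using nq by linarith
    have Sk: "real (Suc k) = of_int \<lfloor>real n * q - x\<rfloor>" using fl by (simp add: k_def)
    have k: "real (Suc k) \<le> real n * q - x" "real n * q - x - 1 \<le> real (Suc k)"
      unfolding Sk by linarith+
    let ?T = "map_pmf Suc (jump_kernel p 0)"
    define a where "a = measure ?T {Suc B..}"
    have aJ: "a = measure (jump_kernel p 0) {B..}" by (simp add: a_def vimage_def atLeast_def)
    have a0: "a \<ge> 0" by (simp add: a_def)
    have ka: "real k * a \<le> 1 / 560"
    proof -
      have "real n * q \<le> real n" using q by (simp add: mult_left_le)
      then have "real k \<le> real n" using k x2 by simp
      then have "real k * a \<le> real n * (C * real B powr (- p))"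
        unfolding aJ by (intro mult_mono Jup B1) auto
      also have "\<dots> = C * (real n * real B powr (- p))" by simp
      also have "\<dots> \<le> C * (1 / \<kappa>)" using Bp C by (intro mult_left_mono) auto
      finally show ?thesis using C\<kappa> by linarith
    qed
    have "1 / 280 \<le> measure (iid_sum (map_pmf (min (Suc B)) ?T) k) {r. n \<le> Suc B + r}"
    proof (rule prob_returns_without_big_jump_ge[where y = "x + 2", OF p0 assms(2) _ B1])
      show "real n * pmf \<pi> 0 - (x + 2) \<le> real k" using k unfolding q_def by simp
      have "real n * measure \<pi> {Suc B..} \<le> real n * measure \<pi> {B..}"
        by (intro mult_left_mono measure_pmf.finite_measure_mono) auto
      also have "\<dots> \<le> real n * (C * real B powr (1 - p))"
        by (intro mult_left_mono \<pi>up B1) auto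
      also have "\<dots> = C * real B * (real n * real B powr (- p))"
        using B1 powr_add[of "real B" 1 "- p"] by simp
      also have "\<dots> \<le> C * real B * (1 / \<kappa>)" using Bp C by (intro mult_left_mono) auto
      also have "\<dots> = real B * (C * (1 / \<kappa>))" by simp
      also have "\<dots> \<le> real B * (1 / 560)" using C\<kappa> by (intro mult_left_mono) auto
      finally have "real n * measure \<pi> {Suc B..} \<le> real B / 560" by simp
      moreover have "(x + 2) / q \<le> (2 * x) / q" using x2 q by (intro divide_right_mono) auto
      moreover have four: "(2 * x) / q = (4 * x / q) / 2" by simp
      ultimately show "real n * measure \<pi> {Suc B..} + (x + 2) / pmf \<pi> 0 \<le> 3 / 4 * real B"
        using B(1) unfolding q_def[symmetric] using four by linarith
    qed (use q x2 q_def in auto)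
    then have half: "1 / 560 \<le> measure (iid_sum (map_pmf (min (Suc B)) ?T) k) {r. n \<le> Suc B + r} - real k * a"
      using ka by linarith
    have "(1 / \<kappa>) * (real n / x powr p) \<le> D * (real n / x powr p)"
      using \<kappa>(1) \<kappa>0 D x2 by (intro mult_right_mono) (auto simp: field_simps)
    also have "\<dots> = (real n * q / 2) * (c * (5 * x / q) powr (- p)) * (1 / 560)"
    proof -
      have "(5 * x / q) powr (- p) = (5 / q) powr (- p) * (1 / x powr p)"
        using q x2 powr_mult[of "5 / q" x "- p"] by (simp add: powr_minus_divide)
      then show ?thesis by (simp add: D_def)
    qed
    also have "\<dots> \<le> (real n * q / 2) * (c * real B powr (- p)) * (1 / 560)"
      using B B1 q c p0 by (intro mult_right_mono mult_left_mono powr_mono2') auto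
    also have "\<dots> \<le> real (Suc k) * a * (1 / 560)"
    proof (intro mult_right_mono mult_mono)
      show "real n * q / 2 \<le> real (Suc k)" using k nq by linarith
      show "c * real B powr (- p) \<le> a" unfolding aJ by (rule Jlo[OF B1])
    qed (use c in auto)
    also have "\<dots> \<le> real (Suc k) * a * (measure (iid_sum (map_pmf (min (Suc B)) ?T) k) {r. n \<le> Suc B + r} - real k * a)"
      using half a0 by (intro mult_left_mono) auto
    also have "\<dots> \<le> measure (iid_sum ?T (Suc k)) {r. n \<le> r}"
      using one_big_jump[of k ?T "Suc B" n 0] unfolding a_def by (simp only: add_0)
    also have "\<dots> \<le> \<P>(\<omega> in M. (\<Sum>i<n. centered_indicator \<pi> (Y i \<omega>)) \<ge> x)"
      by (rule prob_centered_sum_ge[OF assms(3,4) k(1)[unfolded q_def]])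
    finally show ?thesis .
  qed
  show ?thesis using \<kappa>0 main by (intro exI[of _ \<kappa>]) auto
qed

end
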